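(* Let $\mathbf{y}_{1:n}$ be the random output trajectory of the stochastic dynamical system $\Phi$, and let $\mathscr{F}$ be an online probabilistic predictor with information set $\mathcal{I}$ and one-step predictive densities $\hat{p}_{\mathbf{y}_k\mid\mathbf{y}_{1:k-1}}(\cdot\mid y_{1:k-1})=\mathscr{F}_k(y_{1:k-1};\mathcal{I})$. Then the expected log-likelihood functional can be formally evaluated as $$\mathcal{L}(\mathscr{F},\mathbf{y}_{1:n})=-\mathrm{H}(\mathbf{y}_{1:n})-\sum_{k=1}^{n}\mathbb{E}_{y_{1:k-1}}D_{KL}\left(q_k\,\Vert\,\hat{q}_k\right),$$ where $q_k=p_{\mathbf{y}_k\mid\mathbf{y}_{1:k-1}}(\cdot\mid y_{1:k-1})$ is the true conditional density of $\mathbf{y}_k$ given $\mathbf{y}_{1:k-1}=y_{1:k-1}$ and $\hat{q}_k=\hat{p}_{\mathbf{y}_k\mid\mathbf{y}_{1:k-1}}(\cdot\mid y_{1:k-1})$.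
   Context: System $\Phi$: $\mathbf{x}_k=f(\mathbf{x}_{k-1},\mathbf{u}_{k-1})+\mathbf{w}_{k-1}$, $\mathbf{y}_k=h(\mathbf{x}_k)+\mathbf{v}_k$, with states $\mathbf{x}_k\in\mathbb{R}^{d_x}$, inputs $\mathbf{u}_k\in\mathbb{R}^{d_u}$, independent process noises $\mathbf{w}_k\in\mathbb{R}^{d_x}$, outputs $\mathbf{y}_k\in\mathbb{R}^{d_y}$, independent observation noises $\mathbf{v}_k\in\mathbb{R}^{d_y}$; there is no cross-correlation among $\mathbf{w}_k,\mathbf{v}_k,\mathbf{u}_k$, and $\mathbf{x}_0$ is independent of them. Random vectors are described by probability density functions; $p_{\mathbf{y}_k\mid\mathbf{y}_{1:k-1}}$ is the true conditional density. Notation $(\cdot)_{1:k}=(\cdot)_1,\dots,(\cdot)_k$. Predictor: an online probabilistic predictor $\mathscr{F}=(\mathscr{F}_k)_{k=1}^n$ with information set $\mathcal{I}$ (whatever it knows about $f,h$ and the distributions of the random vectors) outputs at time $k$, from the observed $y_{1:k-1}$, a probability density $\mathscr{F}_k(y_{1:k-1};\mathcal{I})=\hat{p}_{\mathbf{y}_k\mid\mathbf{y}_{1:k-1}}(\cdot\mid y_{1:k-1})$ on $\mathbb{R}^{d_y}$. Log-likelihood functional: $\mathcal{L}(\mathscr{F},y_{1:n}):=\sum_{k=1}^n\log\hat{p}_{\mathbf{y}_k\mid\mathbf{y}_{1:k-1}}(y_k\mid y_{1:k-1})$. Expected log-likelihood functional: $\mathcal{L}(\mathscr{F},\mathbf{y}_{1:n}):=\mathbb{E}_{y_{1:n}}\mathcal{L}(\mathscr{F},y_{1:n})$,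 with $y_{1:n}$ distributed as $\mathbf{y}_{1:n}$ (true law). $\mathrm{H}(\mathbf{y}_{1:n}):=-\int p_{\mathbf{y}_{1:n}}\log p_{\mathbf{y}_{1:n}}$ is the joint differential entropy, and $D_{KL}(q\Vert\hat q):=\int q(s)\log\frac{q(s)}{\hat q(s)}\,\mathrm{d}s$. *)

theory Defs
  imports "HOL-Probability.Probability"
begin

text \<open>
  Logarithmic quantities are extended-real valued: a predictive density may vanish, in which case
  the log-likelihood is \<open>-\<infinity>\<close> and the Kullback--Leibler divergence may be \<open>\<infinity>\<close>.  (Bochner integrals, and
  hence \<^const>\<open>KL_divergence\<close>, return 0 for divergent integrals, and \<open>ln 0 = 0\<close> on the reals.)
\<close>

definition eln :: "ereal \<Rightarrow> ereal" where
  "eln t = (if t \<le> 0 then -\<infinity> else if t = \<infinity> then \<infinity> else ereal (ln (real_of_ereal t)))"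

text \<open>
  The extended Lebesgue integral, positive part minus negative part.  It is meaningful for
  measurable integrands for which the two parts are not both infinite.
\<close>

definition ext_integral :: "'a measure \<Rightarrow> ('a \<Rightarrow> ereal) \<Rightarrow> ereal" where
  "ext_integral N g =
     enn2ereal (\<integral>\<^sup>+ x. e2ennreal (g x) \<partial>N) - enn2ereal (\<integral>\<^sup>+ x. e2ennreal (- g x) \<partial>N)"

definition ext_integral_exists :: "'a measure \<Rightarrow> ('a \<Rightarrow> ereal) \<Rightarrow> bool" where
  "ext_integral_exists N g \<longleftrightarrow> g \<in> borel_measurable N \<and>
     \<not> ((\<integral>\<^sup>+ x. e2ennreal (g x) \<partial>N) = \<infinity> \<and> (\<integral>\<^sup>+ x. e2ennreal (- g x) \<partial>N) = \<infinity>)"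


text \<open>
  Vanishing cross-covariance of all pairs of components, wherever the cross-covariance is
  defined.  In particular it is implied by independence, without moment assumptions.
\<close>

definition no_cross_correlation ::
  "'a measure \<Rightarrow> ('a \<Rightarrow> real^'m) \<Rightarrow> ('a \<Rightarrow> real^'n) \<Rightarrow> bool" where
  "no_cross_correlation M X Y \<longleftrightarrow> (\<forall>i j.
     integrable M (\<lambda>\<omega>. X \<omega> $ i) \<longrightarrow> integrable M (\<lambda>\<omega>. Y \<omega> $ j) \<longrightarrow>
     integrable M (\<lambda>\<omega>. X \<omega> $ i * Y \<omega> $ j) \<longrightarrow>
     (\<integral>\<omega>. X \<omega> $ i * Y \<omega> $ j \<partial>M) = (\<integral>\<omega>. X \<omega> $ i \<partial>M) * (\<integral>\<omega>. Y \<omega> $ j \<partial>M))"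

definition has_density :: "'a measure \<Rightarrow> ('a \<Rightarrow> 'b::euclidean_space) \<Rightarrow> bool" where
  "has_density M X \<longleftrightarrow> (\<exists>g. distributed M lborel X g)"

text \<open>
  States, inputs and process noises are indexed by \<open>k \<ge> 0\<close>, outputs and observation noises by
  \<open>k \<ge> 1\<close>; the values \<open>y 0\<close> and \<open>v 0\<close> are irrelevant.
\<close>

locale stochastic_system = prob_space M
  for M :: "'a measure" +
  fixes f :: "real^'dx \<Rightarrow> real^'du \<Rightarrow> real^'dx"
    and h :: "real^'dx \<Rightarrow> real^'dy"
    and x :: "nat \<Rightarrow> 'a \<Rightarrow> real^'dx"
    and u :: "nat \<Rightarrow> 'a \<Rightarrow> real^'du"
    and w :: "nat \<Rightarrow> 'a \<Rightarrow> real^'dx"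
    and v :: "nat \<Rightarrow> 'a \<Rightarrow> real^'dy"
    and y :: "nat \<Rightarrow> 'a \<Rightarrow> real^'dy"
  assumes state_rv: "\<And>k. random_variable borel (x k)"
    and output_rv: "\<And>k. 1 \<le> k \<Longrightarrow> random_variable borel (y k)"
    and state_eq: "\<And>k \<omega>. 1 \<le> k \<Longrightarrow> \<omega> \<in> space M \<Longrightarrow>
                     x k \<omega> = f (x (k - 1) \<omega>) (u (k - 1) \<omega>) + w (k - 1) \<omega>"
    and output_eq: "\<And>k \<omega>. 1 \<le> k \<Longrightarrow> \<omega> \<in> space M \<Longrightarrow> y k \<omega> = h (x k \<omega>) + v k \<omega>"
    and initial_density: "has_density M (x 0)"
    and input_density: "\<And>k. has_density M (u k)"
    and process_noise_density: "\<And>k. has_density M (w k)"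
    and observation_noise_density: "\<And>k. 1 \<le> k \<Longrightarrow> has_density M (v k)"
    and process_noise_indep: "indep_vars (\<lambda>_. borel) w UNIV"
    and observation_noise_indep: "indep_vars (\<lambda>_. borel) v {1..}"
    and uncorrelated_w_v: "\<And>j k. 1 \<le> k \<Longrightarrow> no_cross_correlation M (w j) (v k)"
    and uncorrelated_w_u: "\<And>j k. no_cross_correlation M (w j) (u k)"
    and uncorrelated_v_u: "\<And>j k. 1 \<le> j \<Longrightarrow> no_cross_correlation M (v j) (u k)"
    and initial_indep: "indep_set
           (sets (vimage_algebra (space M) (x 0) borel))
           (sets (vimage_algebra (space M) (\<lambda>\<omega> k. (u k \<omega>, w k \<omega>, v (Suc k) \<omega>))
                    (\<Pi>\<^sub>M k\<in>UNIV. borel \<Otimes>\<^sub>M borel \<Otimes>\<^sub>M borel)))"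


text \<open>
  A trajectory \<open>y\<^sub>1, \<dots>, y\<^sub>k\<close> is a function on the index set \<open>{1..k}\<close> (extensional, i.e.
  \<^const>\<open>undefined\<close> elsewhere), and the product of Lebesgue measures is the reference measure.
\<close>

abbreviation traj_space :: "nat \<Rightarrow> (nat \<Rightarrow> real^'d) measure" where
  "traj_space k \<equiv> (\<Pi>\<^sub>M i\<in>{1..k}. lborel)"

definition traj :: "(nat \<Rightarrow> 'a \<Rightarrow> real^'d) \<Rightarrow> nat \<Rightarrow> 'a \<Rightarrow> nat \<Rightarrow> real^'d" where
  "traj y k \<omega> = (\<lambda>i\<in>{1..k}. y i \<omega>)"

definition past :: "nat \<Rightarrow> (nat \<Rightarrow> real^'d) \<Rightarrow> nat \<Rightarrow> real^'d" where
  "past k ys = restrict ys {1..k-1}"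

definition traj_law :: "'a measure \<Rightarrow> (nat \<Rightarrow> 'a \<Rightarrow> real^'d) \<Rightarrow> nat \<Rightarrow> (nat \<Rightarrow> real^'d) measure" where
  "traj_law M y k = distr M (traj_space k) (traj y k)"

definition joint_densities ::
  "'a measure \<Rightarrow> (nat \<Rightarrow> 'a \<Rightarrow> real^'d) \<Rightarrow> nat \<Rightarrow> (nat \<Rightarrow> (nat \<Rightarrow> real^'d) \<Rightarrow> real) \<Rightarrow> bool" where
  "joint_densities M y n p \<longleftrightarrow> (\<forall>k\<le>n. (\<forall>ys. 0 \<le> p k ys) \<and>
     distributed M (traj_space k) (traj y k) (\<lambda>ys. ennreal (p k ys)))"

text \<open>
  The conditional density of \<open>y\<^sub>k\<close> given \<open>y\<^sub>1, \<dots>, y\<^sub>k\<^sub>-\<^sub>1\<close>, where \<open>p k\<close> is the density of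
  \<open>y\<^sub>1, \<dots>, y\<^sub>k\<close>.  It is 0 on the null event that the denominator vanishes.
\<close>

definition cond_density ::
  "(nat \<Rightarrow> (nat \<Rightarrow> real^'d) \<Rightarrow> real) \<Rightarrow> nat \<Rightarrow> (nat \<Rightarrow> real^'d) \<Rightarrow> real^'d \<Rightarrow> real" where
  "cond_density p k ys s = p k (ys(k := s)) / p (k - 1) ys"

definition diff_entropy :: "nat \<Rightarrow> (nat \<Rightarrow> (nat \<Rightarrow> real^'d) \<Rightarrow> real) \<Rightarrow> ereal" where
  "diff_entropy n p =
     - ext_integral (traj_space n) (\<lambda>ys. ereal (p n ys) * eln (ereal (p n ys)))"

definition diff_entropy_exists :: "nat \<Rightarrow> (nat \<Rightarrow> (nat \<Rightarrow> real^'d) \<Rightarrow> real) \<Rightarrow> bool" where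
  "diff_entropy_exists n p \<longleftrightarrow>
     ext_integral_exists (traj_space n) (\<lambda>ys. ereal (p n ys) * eln (ereal (p n ys)))"

text \<open>
  Since \<open>0 * \<plusminus>\<infinity> = 0\<close>, \<open>0 / 0 = 0\<close> and \<open>a / 0 = \<infinity>\<close> for \<open>a > 0\<close> on \<^typ>\<open>ereal\<close>, the
  integrand is 0 where \<open>q = 0\<close>, and \<open>\<infinity>\<close> where \<open>q > 0\<close> and \<open>q' = 0\<close>.
\<close>

definition KL_div :: "('b::euclidean_space \<Rightarrow> real) \<Rightarrow> ('b \<Rightarrow> real) \<Rightarrow> ereal" where
  "KL_div q q' =
     ext_integral lborel (\<lambda>s. ereal (q s) * eln (ereal (q s) / ereal (q' s)))"


text \<open>
  A predictor maps the time \<open>k\<close>, the past outputs and an information set (of arbitrary type) to a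
  probability density.  Joint measurability in past and present is implicit in speaking of
  expectations over trajectories.
\<close>

type_synonym ('i, 'd) predictor =
  "nat \<Rightarrow> (nat \<Rightarrow> real^'d) \<Rightarrow> 'i \<Rightarrow> real^'d \<Rightarrow> real"

definition online_predictor :: "nat \<Rightarrow> ('i, 'd::finite) predictor \<Rightarrow> 'i \<Rightarrow> bool" where
  "online_predictor n F I \<longleftrightarrow> (\<forall>k\<in>{1..n}.
     (\<lambda>(ys, s). F k ys I s) \<in> borel_measurable (traj_space (k - 1) \<Otimes>\<^sub>M lborel) \<and>
     (\<forall>ys\<in>space (traj_space (k - 1)).
        (\<forall>s. 0 \<le> F k ys I s) \<and> (\<integral>\<^sup>+ s. ennreal (F k ys I s) \<partial>lborel) = 1))"

definition log_likelihood ::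
  "nat \<Rightarrow> ('i, 'd::finite) predictor \<Rightarrow> 'i \<Rightarrow> (nat \<Rightarrow> real^'d) \<Rightarrow> ereal" where
  "log_likelihood n F I ys = (\<Sum>k=1..n. eln (ereal (F k (past k ys) I (ys k))))"

definition expected_log_likelihood ::
  "'a measure \<Rightarrow> (nat \<Rightarrow> 'a \<Rightarrow> real^'d) \<Rightarrow> nat \<Rightarrow> ('i, 'd::finite) predictor \<Rightarrow> 'i \<Rightarrow> ereal" where
  "expected_log_likelihood M y n F I = ext_integral (traj_law M y n) (log_likelihood n F I)"

definition expected_KL ::
  "'a measure \<Rightarrow> (nat \<Rightarrow> 'a \<Rightarrow> real^'d) \<Rightarrow> (nat \<Rightarrow> (nat \<Rightarrow> real^'d) \<Rightarrow> real) \<Rightarrow>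
   ('i, 'd::finite) predictor \<Rightarrow> 'i \<Rightarrow> nat \<Rightarrow> ereal" where
  "expected_KL M y p F I k =
     ext_integral (traj_law M y (k - 1)) (\<lambda>ys. KL_div (cond_density p k ys) (F k ys I))"

end

theory Submission
  imports Defs
begin

text \<open>
  By the chain rule \<open>p n = \<Prod>k\<le>n. q\<^sub>k\<close> along almost every trajectory, so the log-likelihood is
  \<open>ln (p n)\<close> minus the sum of the log-ratios \<open>ln (q\<^sub>k / q'\<^sub>k)\<close> of true and predicted conditional
  densities. Tonelli's theorem identifies the expectation of the \<open>k\<close>-th log-ratio with the expected
  divergence; its negative part is integrable because \<open>q ln (q' / q) \<le> q'\<close>. The expectation of the
  difference splits because the two terms are never \<open>\<infinity> - \<infinity>\<close>.
\<close>

declare One_nat_def [simp del] \<comment> \<open>keeps the index sets \<open>{1..k}\<close> from becoming \<open>{Suc 0..k}\<close>\<close>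

section \<open>Logarithm and positive parts on the extended reals\<close>

lemma eln_ereal_pos: "0 < r \<Longrightarrow> eln (ereal r) = ereal (ln r)"
  by (simp add: eln_def)

lemma borel_measurable_eln [measurable]: "eln \<in> borel_measurable borel"
  unfolding eln_def by measurable

text \<open>Lets a density factor leave the positive part, so that integrals of
  \<open>q * eln ...\<close> become integrals against a law with density \<open>q\<close>. For
  infinite \<open>t\<close> the sides agree because \<open>0 * \<infinity> = 0\<close> in both
  types.\<close>

lemma e2ennreal_ereal_mult:
  assumes "0 \<le> q"
  shows "e2ennreal (ereal q * t) = ennreal q * e2ennreal t"
proof (cases t)
  case (real r)
  then show ?thesis
    using assms by (cases "0 \<le> r") (auto simp: ennreal_mult ennreal_neg mult_nonneg_nonpos)
next
  case PInf
  then show ?thesis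
    using assms by (cases "q = 0") (auto simp: ennreal_mult_top)
next
  case MInf
  then show ?thesis
    using assms by (cases "q = 0") (auto simp: e2ennreal_neg)
qed

text \<open>Subtraction-free form of the fact that positive minus negative part is additive; it
  survives integration even when some parts have infinite integral. The assumption excludes opposite
  infinities.\<close>

lemma e2ennreal_add_parts:
  assumes "g \<noteq> \<infinity> \<and> h \<noteq> \<infinity> \<or> g \<noteq> -\<infinity> \<and> h \<noteq> -\<infinity>"
  shows "e2ennreal (g + h) + (e2ennreal (- g) + e2ennreal (- h)) =
         e2ennreal (- (g + h)) + (e2ennreal g + e2ennreal h)"
proof (cases g; cases h)
  fix a b assume gh: "g = ereal a" "h = ereal b"
  \<comment> \<open>With \<open>max 0 r\<close> every argument is visibly nonnegative, so the sums
    in \<open>ennreal\<close> become sums of reals.\<close>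
  have parts: "ennreal r = ennreal (max 0 r)" for r
    by (cases "0 \<le> r") (auto simp: ennreal_neg max_def)
  show ?thesis
    unfolding gh plus_ereal.simps uminus_ereal.simps e2ennreal_ereal
    by (subst (1 2 3 4 5 6) parts) (simp flip: ennreal_plus add: max_def)
qed (use assms in \<open>auto simp: e2ennreal_neg\<close>)

lemma e2ennreal_add_le: "e2ennreal (g + h) \<le> e2ennreal g + e2ennreal h"
proof (cases g; cases h)
  fix a b assume "g = ereal a" "h = ereal b"
  then show ?thesis
    by (cases "0 \<le> a"; cases "0 \<le> b")
       (auto simp: ennreal_neg intro!: ennreal_leI simp flip: ennreal_plus)
qed (auto simp: e2ennreal_neg)

text \<open>Opposite infinities need their own case: there \<open>g + h = \<infinity>\<close>, so
  \<open>- (g + h)\<close> is \<open>-\<infinity>\<close> although \<open>- g + - h\<close> is again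
  \<open>\<infinity>\<close>. Otherwise negation distributes and subadditivity applies.\<close>

lemma e2ennreal_uminus_add_le: "e2ennreal (- (g + h)) \<le> e2ennreal (- g) + e2ennreal (- h)"
proof (cases "\<bar>g\<bar> = \<infinity> \<and> \<bar>h\<bar> = \<infinity>")
  case True
  then show ?thesis
    by (auto simp: e2ennreal_neg)
next
  case False
  then have "- (g + h) = - g + - h"
    by (cases g; cases h) auto
  then show ?thesis
    by (simp add: e2ennreal_add_le)
qed

section \<open>Linearity of the extended integral\<close>

lemma ext_integral_cong_AE:
  assumes "AE x in N. g x = h x"
  shows "ext_integral N g = ext_integral N h"
proof -
  have "(\<integral>\<^sup>+ x. e2ennreal (g x) \<partial>N) = (\<integral>\<^sup>+ x. e2ennreal (h x) \<partial>N)"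
       "(\<integral>\<^sup>+ x. e2ennreal (- g x) \<partial>N) = (\<integral>\<^sup>+ x. e2ennreal (- h x) \<partial>N)"
    by (rule nn_integral_cong_AE, use assms in eventually_elim, simp)+
  then show ?thesis
    by (simp add: ext_integral_def)
qed

lemma ext_integral_distr:
  assumes [measurable]: "T \<in> measurable N L" "g \<in> borel_measurable L"
  shows "ext_integral (distr N L T) g = ext_integral N (\<lambda>x. g (T x))"
  by (simp add: ext_integral_def nn_integral_distr)

text \<open>Since \<open>\<infinity> - \<infinity> = \<infinity>\<close> on \<open>ereal\<close>,
  both \<open>g\<close> and \<open>- g\<close> would get the value \<open>\<infinity>\<close> if
  both parts were infinite; the assumption excludes this.\<close>

lemma ext_integral_uminus:
  assumes "(\<integral>\<^sup>+ x. e2ennreal (g x) \<partial>N) \<noteq> \<infinity> \<or> (\<integral>\<^sup>+ x. e2ennreal (- g x) \<partial>N) \<noteq> \<infinity>"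
  shows "ext_integral N (\<lambda>x. - g x) = - ext_integral N g"
  using assms unfolding ext_integral_def
  by (cases "\<integral>\<^sup>+ x. e2ennreal (g x) \<partial>N"; cases "\<integral>\<^sup>+ x. e2ennreal (- g x) \<partial>N")
     (auto simp: enn2ereal_ennreal)

lemma ext_integral_neq_MInf:
  assumes "(\<integral>\<^sup>+ x. e2ennreal (- g x) \<partial>N) \<noteq> \<infinity>"
  shows "ext_integral N g \<noteq> -\<infinity>"
  using assms unfolding ext_integral_def
  by (cases "\<integral>\<^sup>+ x. e2ennreal (g x) \<partial>N"; cases "\<integral>\<^sup>+ x. e2ennreal (- g x) \<partial>N")
     (auto simp: enn2ereal_ennreal)

lemma AE_e2ennreal_finite:
  assumes "(\<integral>\<^sup>+ x. e2ennreal (g x) \<partial>N) \<noteq> \<infinity>" "g \<in> borel_measurable N"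
  shows "AE x in N. g x \<noteq> \<infinity>"
proof -
  have "AE x in N. e2ennreal (g x) \<noteq> \<infinity>"
    by (rule nn_integral_PInf_AE) (use assms in auto)
  then show ?thesis
    by eventually_elim auto
qed

text \<open>If \<open>N\<close> is infinite, so is \<open>a\<close> or \<open>b\<close>, and both
  sides are \<open>-\<infinity>\<close>. If \<open>N\<close> is finite, so are all six quantities,
  and the claim is real arithmetic.\<close>

lemma enn2ereal_diff_add:
  assumes eq: "P + (a + b) = N + (c + d)" and fin: "c \<noteq> \<infinity>" "d \<noteq> \<infinity>" "P \<noteq> \<infinity>"
  shows "enn2ereal P - enn2ereal N = enn2ereal c - enn2ereal a + (enn2ereal d - enn2ereal b)"
proof (cases "N = \<infinity>")
  case True
  then have "a = \<infinity> \<or> b = \<infinity>"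
    using eq fin by auto
  then show ?thesis
    using True fin by (cases c; cases d; cases P; cases a; cases b) (auto simp: enn2ereal_ennreal)
next
  case False
  have "N + (c + d) \<noteq> \<infinity>"
    using False fin by simp
  then have "a \<noteq> \<infinity>" "b \<noteq> \<infinity>"
    unfolding eq[symmetric] by auto
  have real: "\<exists>r. enn2ereal t = ereal r" if "t \<noteq> \<infinity>" for t
    using that by (cases t) (auto simp: enn2ereal_ennreal)
  have "enn2ereal P + (enn2ereal a + enn2ereal b) = enn2ereal N + (enn2ereal c + enn2ereal d)"
    using arg_cong[OF eq, of enn2ereal] by (simp add: plus_ennreal.rep_eq)
  moreover note real[OF False] real[OF fin(1)] real[OF fin(2)] real[OF fin(3)]
    real[OF \<open>a \<noteq> \<infinity>\<close>] real[OF \<open>b \<noteq> \<infinity>\<close>]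
  ultimately show ?thesis
    by auto
qed

text \<open>Negates both sides, which carries the case of finite positive parts over to that of
  finite negative parts. Finiteness of \<open>a\<close>, \<open>b\<close> and \<open>N\<close> keeps
  each negated difference away from \<open>\<infinity> - \<infinity>\<close>.\<close>

lemma enn2ereal_diff_add_flip:
  assumes "enn2ereal N - enn2ereal P = enn2ereal a - enn2ereal c + (enn2ereal b - enn2ereal d)"
    and fin: "a \<noteq> \<infinity>" "b \<noteq> \<infinity>" "N \<noteq> \<infinity>"
  shows "enn2ereal P - enn2ereal N = enn2ereal c - enn2ereal a + (enn2ereal d - enn2ereal b)"
proof -
  have flip: "s - r = - (r - s)" if "\<bar>r\<bar> \<noteq> \<infinity>" for r s :: ereal
    using that by (cases r; cases s) auto
  have fin': "\<bar>enn2ereal t\<bar> \<noteq> \<infinity>" if "t \<noteq> \<infinity>" for t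
    using that by (cases t) (auto simp: enn2ereal_ennreal)
  have neg: "- (r + s) = - r + - s" if "r \<noteq> \<infinity>" "s \<noteq> \<infinity>" for r s :: ereal
    using that by (cases r; cases s) auto
  have less: "enn2ereal r - enn2ereal s \<noteq> \<infinity>" if "r \<noteq> \<infinity>" for r s
    using that by (cases r; cases s) (auto simp: enn2ereal_ennreal)
  show ?thesis
    unfolding flip[OF fin'[OF fin(1)], of "enn2ereal c"] flip[OF fin'[OF fin(2)], of "enn2ereal d"]
      flip[OF fin'[OF fin(3)], of "enn2ereal P"] assms(1)
    by (rule neg) (use less fin in auto)
qed

text \<open>Integrate \<open>e2ennreal_add_parts\<close>, which is available almost everywhere
  because a function with finite integral is almost everywhere finite, then solve for the
  differences. The two finiteness conclusions allow the result to be iterated and give existence of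
  the integral of the sum.\<close>

lemma ext_integral_add:
  assumes [measurable]: "g \<in> borel_measurable N" "h \<in> borel_measurable N"
    and fin: "(\<integral>\<^sup>+ x. e2ennreal (g x) \<partial>N) \<noteq> \<infinity> \<and> (\<integral>\<^sup>+ x. e2ennreal (h x) \<partial>N) \<noteq> \<infinity> \<or>
              (\<integral>\<^sup>+ x. e2ennreal (- g x) \<partial>N) \<noteq> \<infinity> \<and> (\<integral>\<^sup>+ x. e2ennreal (- h x) \<partial>N) \<noteq> \<infinity>"
  shows "ext_integral N (\<lambda>x. g x + h x) = ext_integral N g + ext_integral N h"
    and "(\<integral>\<^sup>+ x. e2ennreal (g x) \<partial>N) \<noteq> \<infinity> \<Longrightarrow> (\<integral>\<^sup>+ x. e2ennreal (h x) \<partial>N) \<noteq> \<infinity> \<Longrightarrow>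
         (\<integral>\<^sup>+ x. e2ennreal (g x + h x) \<partial>N) \<noteq> \<infinity>"
    and "(\<integral>\<^sup>+ x. e2ennreal (- g x) \<partial>N) \<noteq> \<infinity> \<Longrightarrow> (\<integral>\<^sup>+ x. e2ennreal (- h x) \<partial>N) \<noteq> \<infinity> \<Longrightarrow>
         (\<integral>\<^sup>+ x. e2ennreal (- (g x + h x)) \<partial>N) \<noteq> \<infinity>"
proof -
  let ?I = "\<lambda>g. \<integral>\<^sup>+ x. e2ennreal (g x) \<partial>N"
  let ?P = "?I (\<lambda>x. g x + h x)" and ?N = "?I (\<lambda>x. - (g x + h x))"
  let ?a = "?I (\<lambda>x. - g x)" and ?b = "?I (\<lambda>x. - h x)" and ?c = "?I g" and ?d = "?I h"
  have "(AE x in N. g x \<noteq> \<infinity>) \<and> (AE x in N. h x \<noteq> \<infinity>) \<or>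
        (AE x in N. - g x \<noteq> \<infinity>) \<and> (AE x in N. - h x \<noteq> \<infinity>)"
    using fin by (auto intro!: AE_e2ennreal_finite)
  then have ae: "AE x in N. g x \<noteq> \<infinity> \<and> h x \<noteq> \<infinity> \<or> g x \<noteq> -\<infinity> \<and> h x \<noteq> -\<infinity>"
    by (auto simp: ereal_uminus_eq_reorder elim: eventually_elim2)
  have "(\<integral>\<^sup>+ x. e2ennreal (g x + h x) + (e2ennreal (- g x) + e2ennreal (- h x)) \<partial>N) =
        (\<integral>\<^sup>+ x. e2ennreal (- (g x + h x)) + (e2ennreal (g x) + e2ennreal (h x)) \<partial>N)"
    by (rule nn_integral_cong_AE, use ae in eventually_elim) (rule e2ennreal_add_parts)
  then have eq: "?P + (?a + ?b) = ?N + (?c + ?d)"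
    by (simp add: nn_integral_add)
  have "?P \<le> (\<integral>\<^sup>+ x. e2ennreal (g x) + e2ennreal (h x) \<partial>N)"
    by (intro nn_integral_mono e2ennreal_add_le)
  then have P: "?P \<le> ?c + ?d"
    by (simp add: nn_integral_add)
  have "?N \<le> (\<integral>\<^sup>+ x. e2ennreal (- g x) + e2ennreal (- h x) \<partial>N)"
    by (intro nn_integral_mono e2ennreal_uminus_add_le)
  then have N: "?N \<le> ?a + ?b"
    by (simp add: nn_integral_add)
  show "?c \<noteq> \<infinity> \<Longrightarrow> ?d \<noteq> \<infinity> \<Longrightarrow> ?P \<noteq> \<infinity>" "?a \<noteq> \<infinity> \<Longrightarrow> ?b \<noteq> \<infinity> \<Longrightarrow> ?N \<noteq> \<infinity>"
    using P N by (auto simp: top_unique)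
  show "ext_integral N (\<lambda>x. g x + h x) = ext_integral N g + ext_integral N h"
    unfolding ext_integral_def
    using fin
  proof (elim disjE conjE)
    assume "?c \<noteq> \<infinity>" "?d \<noteq> \<infinity>"
    with P have "?P \<noteq> \<infinity>" by (auto simp: top_unique)
    with eq \<open>?c \<noteq> \<infinity>\<close> \<open>?d \<noteq> \<infinity>\<close>
    show "enn2ereal ?P - enn2ereal ?N = enn2ereal ?c - enn2ereal ?a + (enn2ereal ?d - enn2ereal ?b)"
      by (rule enn2ereal_diff_add)
  next
    \<comment> \<open>Read \<open>eq\<close> backwards, which exchanges positive and negative parts,
      and negate the resulting identity.\<close>
    assume "?a \<noteq> \<infinity>" "?b \<noteq> \<infinity>"
    with N have "?N \<noteq> \<infinity>" by (auto simp: top_unique)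
    have "enn2ereal ?N - enn2ereal ?P = enn2ereal ?a - enn2ereal ?c + (enn2ereal ?b - enn2ereal ?d)"
      by (rule enn2ereal_diff_add[OF eq[symmetric]]) fact+
    from this \<open>?a \<noteq> \<infinity>\<close> \<open>?b \<noteq> \<infinity>\<close> \<open>?N \<noteq> \<infinity>\<close>
    show "enn2ereal ?P - enn2ereal ?N = enn2ereal ?c - enn2ereal ?a + (enn2ereal ?d - enn2ereal ?b)"
      by (rule enn2ereal_diff_add_flip)
  qed
qed

text \<open>\<open>A\<close> and \<open>B\<close> may both be positive at the same point, so they
  need not be the positive and negative part of the integrand; additivity closes this gap.\<close>

lemma ext_integral_diff_nonneg:
  assumes [measurable]: "A \<in> borel_measurable N" "B \<in> borel_measurable N"
    and fin: "(\<integral>\<^sup>+ x. B x \<partial>N) \<noteq> \<infinity>"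
  shows "ext_integral N (\<lambda>x. enn2ereal (A x) - enn2ereal (B x)) =
         enn2ereal (\<integral>\<^sup>+ x. A x \<partial>N) - enn2ereal (\<integral>\<^sup>+ x. B x \<partial>N)"
proof -
  have "ext_integral N (\<lambda>x. enn2ereal (A x) + - enn2ereal (B x)) =
        ext_integral N (\<lambda>x. enn2ereal (A x)) + ext_integral N (\<lambda>x. - enn2ereal (B x))"
    by (rule ext_integral_add) (use fin in \<open>auto simp: e2ennreal_neg\<close>)
  then show ?thesis
    by (simp add: ext_integral_def e2ennreal_neg minus_ereal_def zero_ennreal.rep_eq)
qed

text \<open>Finiteness of the positive part is proved along with the equation because the induction
  step needs it for the partial sum.\<close>

lemma ext_integral_sum:
  assumes "finite K"
    and [measurable]: "\<And>k. k \<in> K \<Longrightarrow> g k \<in> borel_measurable N"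
    and "\<And>k. k \<in> K \<Longrightarrow> (\<integral>\<^sup>+ x. e2ennreal (g k x) \<partial>N) \<noteq> \<infinity>"
  shows "ext_integral N (\<lambda>x. \<Sum>k\<in>K. g k x) = (\<Sum>k\<in>K. ext_integral N (g k)) \<and>
         (\<integral>\<^sup>+ x. e2ennreal (\<Sum>k\<in>K. g k x) \<partial>N) \<noteq> \<infinity>"
  using assms
proof (induction K rule: finite_induct)
  case empty
  then show ?case by (simp add: ext_integral_def)
next
  case (insert k K)
  then have [measurable]: "g k \<in> borel_measurable N"
    "(\<lambda>x. \<Sum>k\<in>K. g k x) \<in> borel_measurable N"
    by auto
  from insert show ?case
    using ext_integral_add(1,2)[of "g k" N "\<lambda>x. \<Sum>k\<in>K. g k x"] by simp
qed

section \<open>The divergence integrand, and densities along a trajectory\<close>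

text \<open>Apply \<open>ln t \<le> t\<close> at \<open>t = q' / q\<close>. The integrand is 0 for
  \<open>q = 0\<close> and \<open>\<infinity>\<close> for \<open>q > 0\<close>,
  \<open>q' = 0\<close>, so it has no negative part in these cases.\<close>

lemma KL_integrand_neg_part_le:
  assumes "0 \<le> q" "0 \<le> q'"
  shows "e2ennreal (- (ereal q * eln (ereal q / ereal q'))) \<le> ennreal q'"
proof (cases "q = 0 \<or> q' = 0")
  case True
  then show ?thesis
    using assms by (cases "q = 0") (auto simp: eln_def e2ennreal_neg zero_ereal_def[symmetric] divide_ereal_def)
next
  case False
  then have pos: "0 < q" "0 < q'" using assms by auto
  have "q * ln (q' / q) \<le> q * (q' / q)"
    using pos ln_bound[of "q' / q"] by (intro mult_left_mono) auto
  then have "- (q * ln (q / q')) \<le> q'"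
    using pos by (simp add: ln_div algebra_simps)
  then show ?thesis
    using pos by (simp add: eln_ereal_pos ennreal_leI)
qed

lemma traj_Suc: "traj y (Suc k) \<omega> = (traj y k \<omega>)(Suc k := y (Suc k) \<omega>)"
  by (auto simp: traj_def fun_eq_iff)

lemma joint_densitiesD:
  assumes "joint_densities M y n p" "k \<le> n"
  shows "distributed M (traj_space k) (traj y k) (\<lambda>ys. ennreal (p k ys))"
    and "0 \<le> p k ys"
    and "p k \<in> borel_measurable (traj_space k)"
    and "traj y k \<in> measurable M (traj_space k)"
proof -
  show d: "distributed M (traj_space k) (traj y k) (\<lambda>ys. ennreal (p k ys))"
    and pos: "0 \<le> p k ys" for ys
    using assms by (auto simp: joint_densities_def)
  have "(\<lambda>ys. enn2real (ennreal (p k ys))) \<in> borel_measurable (traj_space k)"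
    using distributed_borel_measurable[OF d] by measurable
  then show "p k \<in> borel_measurable (traj_space k)"
    using pos by simp
  show "traj y k \<in> measurable M (traj_space k)"
    using d by (rule distributed_measurable)
qed

lemma joint_densities_output_measurable:
  assumes "joint_densities M y n p" "k \<in> {1..n}"
  shows "y k \<in> measurable M lborel"
proof -
  have "traj y k \<in> measurable M (traj_space k)"
    using assms by (auto intro: joint_densitiesD)
  then have "(\<lambda>\<omega>. traj y k \<omega> k) \<in> measurable M lborel"
    by (rule measurable_compose[OF _ measurable_component_singleton]) (use assms(2) in auto)
  then show ?thesis
    using assms(2) by (simp add: traj_def)
qed

text \<open>The zero set of a density is null under the law it defines. Hence almost surely no
  denominator of a conditional density vanishes.\<close>

lemma joint_densities_AE_pos:
  assumes "prob_space M" "joint_densities M y n p" "k \<le> n"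
  shows "AE \<omega> in M. 0 < p k (traj y k \<omega>)"
proof -
  interpret prob_space M by fact
  note [measurable] = joint_densitiesD(3)[OF assms(2,3)]
  show ?thesis
    by (subst distributed_AE2[OF joint_densitiesD(1)[OF assms(2,3)]]) auto
qed

text \<open>The product over the empty index set is one point of mass 1, so the density there is the
  total mass of the law. This is the lower end of the telescoping sum.\<close>

lemma joint_density_0:
  assumes "prob_space M" "joint_densities M y n p"
  shows "p 0 (traj y 0 \<omega>) = 1"
proof -
  interpret prob_space M by fact
  interpret product_sigma_finite "\<lambda>_::nat. lborel :: (real^'b) measure" ..
  note d = joint_densitiesD(1)[OF assms(2), of 0, simplified]
  have "1 = (\<integral>\<^sup>+ \<omega>. 1 \<partial>M)"
    by (simp add: emeasure_space_1)
  also have "\<dots> = (\<integral>\<^sup>+ ys. ennreal (p 0 ys) * 1 \<partial>PiM {} (\<lambda>_. lborel))"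
    by (rule distributed_nn_integral[OF d, symmetric]) simp
  also have "\<dots> = ennreal (p 0 (\<lambda>_. undefined))"
    by (simp add: nn_integral_empty)
  finally show ?thesis
    using joint_densitiesD(2)[OF assms(2), of 0] by (simp add: traj_def restrict_def)
qed

lemma measurable_traj_upd [measurable]:
  "(\<lambda>(ys, s). ys(Suc j := s)) \<in> measurable (traj_space j \<Otimes>\<^sub>M lborel) (traj_space (Suc j))"
proof -
  have "(\<lambda>(ys, s). ys(Suc j := s)) \<in>
      measurable (traj_space j \<Otimes>\<^sub>M lborel) (PiM (insert (Suc j) {1..j}) (\<lambda>_. lborel))"
    by (rule measurable_add_dim)
  then show ?thesis
    by (simp add: atLeastAtMostSuc_conv)
qed

lemma measurable_cond_density:
  assumes "joint_densities M y n p" "Suc j \<le> n"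
  shows "(\<lambda>(ys, s). cond_density p (Suc j) ys s) \<in> borel_measurable (traj_space j \<Otimes>\<^sub>M lborel)"
proof -
  have [measurable]: "p (Suc j) \<in> borel_measurable (traj_space (Suc j))"
    "p j \<in> borel_measurable (traj_space j)"
    using assms by (auto intro: joint_densitiesD)
  have [measurable]: "(\<lambda>z. p (Suc j) (case z of (ys, s) \<Rightarrow> ys(Suc j := s)))
      \<in> borel_measurable (traj_space j \<Otimes>\<^sub>M lborel)"
    by (rule measurable_compose[OF measurable_traj_upd]) measurable
  have "(\<lambda>z. p (Suc j) (case z of (ys, s) \<Rightarrow> ys(Suc j := s)) / p j (fst z))
      \<in> borel_measurable (traj_space j \<Otimes>\<^sub>M lborel)"
    by measurable
  then show ?thesis
    by (simp add: cond_density_def case_prod_beta)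
qed

text \<open>
  The marginal density cancels against the denominator of the conditional density. The points
  where it vanishes contribute nothing on the left and have probability zero on the right, so
  the consistency of \<open>p j\<close> with \<open>p (Suc j)\<close> under integration over the last coordinate is not needed.
\<close>

lemma nn_integral_cond_density:
  fixes y :: "nat \<Rightarrow> 'a \<Rightarrow> real^'d"
  assumes M: "prob_space M" and dens: "joint_densities M y n p" and j: "Suc j \<le> n"
    and [measurable]: "\<Phi> \<in> borel_measurable (traj_space j \<Otimes>\<^sub>M lborel)"
  shows "(\<integral>\<^sup>+ ys. (\<integral>\<^sup>+ s. ennreal (cond_density p (Suc j) ys s) * \<Phi> (ys, s) \<partial>lborel) \<partial>traj_law M y j) =
         (\<integral>\<^sup>+ \<omega>. \<Phi> (traj y j \<omega>, y (Suc j) \<omega>) \<partial>M)"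
proof -
  interpret product_sigma_finite "\<lambda>_::nat. lborel :: (real^'d) measure" ..
  have j': "j \<le> n" using j by simp
  note [measurable] = joint_densitiesD(3)[OF dens j] joint_densitiesD(3)[OF dens j']
    measurable_cond_density[OF dens j]
  \<comment> \<open>\<open>\<Psi>\<close> is \<open>\<Phi>\<close> as a function of the whole
    trajectory, cut off where \<open>p j\<close> vanishes. The cut-off makes the next identity hold
    at every point, since \<open>p (Suc j)\<close> may be nonzero at points where \<open>p j\<close>
    is zero.\<close>
  define \<Psi> where "\<Psi> zs = indicator {ys. p j ys \<noteq> 0} (restrict zs {1..j}) * \<Phi> (restrict zs {1..j}, zs (Suc j))"
    for zs
  have [measurable]: "(\<lambda>zs. restrict zs {1..j}) \<in> measurable (traj_space (Suc j)) (traj_space j)"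
    by (rule measurable_restrict_subset) auto
  have [measurable]: "(\<lambda>zs. zs (Suc j)) \<in> measurable (traj_space (Suc j)) lborel"
    by (rule measurable_component_singleton) auto
  have [measurable]: "\<Psi> \<in> borel_measurable (traj_space (Suc j))"
    unfolding \<Psi>_def indicator_def by measurable
  have "(\<integral>\<^sup>+ ys. (\<integral>\<^sup>+ s. ennreal (cond_density p (Suc j) ys s) * \<Phi> (ys, s) \<partial>lborel) \<partial>traj_law M y j) =
        (\<integral>\<^sup>+ ys. (\<integral>\<^sup>+ s. ennreal (cond_density p (Suc j) ys s) * \<Phi> (ys, s) \<partial>lborel)
          \<partial>density (traj_space j) (\<lambda>ys. ennreal (p j ys)))"
    using distributed_distr_eq_density[OF joint_densitiesD(1)[OF dens j']]
    by (simp add: traj_law_def)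
  also have "\<dots> = (\<integral>\<^sup>+ ys. ennreal (p j ys) *
      (\<integral>\<^sup>+ s. ennreal (cond_density p (Suc j) ys s) * \<Phi> (ys, s) \<partial>lborel) \<partial>traj_space j)"
    by (subst nn_integral_density) auto
  also have "\<dots> = (\<integral>\<^sup>+ ys. (\<integral>\<^sup>+ s. ennreal (p (Suc j) (ys(Suc j := s))) * \<Psi> (ys(Suc j := s)) \<partial>lborel)
      \<partial>traj_space j)"
  proof (rule nn_integral_cong)
    fix ys :: "nat \<Rightarrow> real^'d" assume ys: "ys \<in> space (traj_space j)"
    have restr: "restrict (ys(Suc j := s)) {1..j} = ys" for s
      using ys by (auto simp: space_PiM PiE_def extensional_def fun_eq_iff)
    have "ennreal (p j ys) * (ennreal (cond_density p (Suc j) ys s) * \<Phi> (ys, s)) =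
          ennreal (p (Suc j) (ys(Suc j := s))) * \<Psi> (ys(Suc j := s))" for s
      unfolding \<Psi>_def restr
      using joint_densitiesD(2)[OF dens j'] joint_densitiesD(2)[OF dens j]
      by (cases "p j ys = 0")
         (auto simp: cond_density_def mult.assoc[symmetric] simp flip: ennreal_mult)
    moreover have "(\<lambda>s. ennreal (cond_density p (Suc j) ys s) * \<Phi> (ys, s)) \<in> borel_measurable lborel"
      using measurable_Pair2[OF _ ys, of "\<lambda>(ys, s). ennreal (cond_density p (Suc j) ys s) * \<Phi> (ys, s)"]
      by simp
    ultimately show "ennreal (p j ys) *
        (\<integral>\<^sup>+ s. ennreal (cond_density p (Suc j) ys s) * \<Phi> (ys, s) \<partial>lborel) =
        (\<integral>\<^sup>+ s. ennreal (p (Suc j) (ys(Suc j := s))) * \<Psi> (ys(Suc j := s)) \<partial>lborel)"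
      by (subst nn_integral_cmult[symmetric]) auto
  qed
  also have "\<dots> = (\<integral>\<^sup>+ zs. ennreal (p (Suc j) zs) * \<Psi> zs \<partial>traj_space (Suc j))"
    using product_nn_integral_insert[of "{1..j}" "Suc j" "\<lambda>zs. ennreal (p (Suc j) zs) * \<Psi> zs"]
    by (simp add: atLeastAtMostSuc_conv[symmetric])
  also have "\<dots> = (\<integral>\<^sup>+ \<omega>. \<Psi> (traj y (Suc j) \<omega>) \<partial>M)"
    by (rule distributed_nn_integral[OF joint_densitiesD(1)[OF dens j]]) measurable
  also have "\<dots> = (\<integral>\<^sup>+ \<omega>. \<Phi> (traj y j \<omega>, y (Suc j) \<omega>) \<partial>M)"
  proof (rule nn_integral_cong_AE, use joint_densities_AE_pos[OF M dens j'] in eventually_elim)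
    fix \<omega> assume pos: "0 < p j (traj y j \<omega>)"
    have "restrict (traj y (Suc j) \<omega>) {1..j} = traj y j \<omega>" "traj y (Suc j) \<omega> (Suc j) = y (Suc j) \<omega>"
      by (auto simp: traj_def fun_eq_iff)
    then show "\<Psi> (traj y (Suc j) \<omega>) = \<Phi> (traj y j \<omega>, y (Suc j) \<omega>)"
      using pos by (simp add: \<Psi>_def)
  qed
  finally show ?thesis .
qed

section \<open>Log-ratios: expected divergence and telescoping\<close>

text \<open>Taken as a random variable on the sample space, so that the terms for different
  \<open>k\<close> can be added under one measure. It is \<open>\<infinity>\<close> where the true
  density is positive and the prediction vanishes.\<close>

definition log_ratio ::
  "(nat \<Rightarrow> 'a \<Rightarrow> real^'d) \<Rightarrow> (nat \<Rightarrow> (nat \<Rightarrow> real^'d) \<Rightarrow> real) \<Rightarrow>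
   ('i, 'd::finite) predictor \<Rightarrow> 'i \<Rightarrow> nat \<Rightarrow> 'a \<Rightarrow> ereal" where
  "log_ratio y p F I k \<omega> =
     eln (ereal (cond_density p k (traj y (k - 1) \<omega>) (y k \<omega>)) /
          ereal (F k (traj y (k - 1) \<omega>) I (y k \<omega>)))"

text \<open>Tonelli needs nonnegative integrands, so the two parts of the divergence integrand are
  averaged separately. They can be recombined because the average of the negative part is at most
  1.\<close>

lemma expected_KL_eq_log_ratio:
  fixes y :: "nat \<Rightarrow> 'a \<Rightarrow> real^'d"
  assumes "prob_space M" and dens: "joint_densities M y n p"
    and pred: "online_predictor n F I" and k: "k \<in> {1..n}"
  shows "log_ratio y p F I k \<in> borel_measurable M"
    and "(\<integral>\<^sup>+ \<omega>. e2ennreal (- log_ratio y p F I k \<omega>) \<partial>M) \<noteq> \<infinity>"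
    and "expected_KL M y p F I k = ext_integral M (log_ratio y p F I k)"
proof -
  interpret prob_space M by fact
  obtain j where j: "k = Suc j" "Suc j \<le> n" "j \<le> n"
    using k by (cases k) auto
  have F [measurable]: "(\<lambda>(ys, s). F k ys I s) \<in> borel_measurable (traj_space j \<Otimes>\<^sub>M lborel)"
    and F_nonneg: "\<And>ys s. ys \<in> space (traj_space j) \<Longrightarrow> 0 \<le> F k ys I s"
    and F_int: "\<And>ys. ys \<in> space (traj_space j) \<Longrightarrow> (\<integral>\<^sup>+ s. ennreal (F k ys I s) \<partial>lborel) = 1"
    using bspec[OF pred[unfolded online_predictor_def] k] by (auto simp: j(1))
  have [measurable]: "traj y j \<in> measurable M (traj_space j)" "y k \<in> measurable M lborel"
    using joint_densitiesD(4)[OF dens j(3)] joint_densities_output_measurable[OF dens k] by auto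
  note [measurable] = measurable_cond_density[OF dens j(2), folded j(1)]
  define q where "q ys s = cond_density p k ys s" for ys s
  have q_nonneg: "0 \<le> q ys s" for ys s
    using joint_densitiesD(2)[OF dens] j by (simp add: q_def cond_density_def)
  define \<phi> where "\<phi> z = eln (ereal (case z of (ys, s) \<Rightarrow> q ys s) / ereal (case z of (ys, s) \<Rightarrow> F k ys I s))"
    for z
  have [measurable]: "\<phi> \<in> borel_measurable (traj_space j \<Otimes>\<^sub>M lborel)"
    unfolding \<phi>_def q_def by measurable
  have ratio: "log_ratio y p F I k = (\<lambda>\<omega>. \<phi> (traj y j \<omega>, y k \<omega>))"
    by (simp add: log_ratio_def \<phi>_def q_def j(1) fun_eq_iff)
  show "log_ratio y p F I k \<in> borel_measurable M"
    unfolding ratio by measurable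
  \<comment> \<open>\<open>A\<close> and \<open>B\<close> are the integrals of the positive and of
    the negative part for a fixed past.\<close>
  define A where "A ys = (\<integral>\<^sup>+ s. ennreal (q ys s) * e2ennreal (\<phi> (ys, s)) \<partial>lborel)" for ys
  define B where "B ys = (\<integral>\<^sup>+ s. ennreal (q ys s) * e2ennreal (- \<phi> (ys, s)) \<partial>lborel)" for ys
  have sets_law [measurable_cong]: "sets (traj_law M y j) = sets (traj_space j)"
    by (simp add: traj_law_def)
  have space_law: "space (traj_law M y j) = space (traj_space j)"
    by (simp add: traj_law_def)
  interpret L: prob_space "traj_law M y j"
    unfolding traj_law_def by (rule prob_space_distr) measurable
  have [measurable]: "A \<in> borel_measurable (traj_law M y j)" "B \<in> borel_measurable (traj_law M y j)"
    unfolding A_def B_def q_def by measurable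
  have A_int: "(\<integral>\<^sup>+ ys. A ys \<partial>traj_law M y j) = (\<integral>\<^sup>+ \<omega>. e2ennreal (log_ratio y p F I k \<omega>) \<partial>M)"
    using nn_integral_cond_density[OF prob_space_axioms dens j(2), of "\<lambda>z. e2ennreal (\<phi> z)"]
    unfolding ratio A_def q_def by (simp add: j(1))
  have B_int: "(\<integral>\<^sup>+ ys. B ys \<partial>traj_law M y j) = (\<integral>\<^sup>+ \<omega>. e2ennreal (- log_ratio y p F I k \<omega>) \<partial>M)"
    using nn_integral_cond_density[OF prob_space_axioms dens j(2), of "\<lambda>z. e2ennreal (- \<phi> z)"]
    unfolding ratio B_def q_def by (simp add: j(1))
  \<comment> \<open>The predictive density dominates the negative part pointwise and has total mass
    1, whatever the past.\<close>
  have "B ys \<le> 1" if ys: "ys \<in> space (traj_space j)" for ys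
  proof -
    have "B ys \<le> (\<integral>\<^sup>+ s. ennreal (F k ys I s) \<partial>lborel)"
      unfolding B_def
    proof (rule nn_integral_mono)
      fix s
      show "ennreal (q ys s) * e2ennreal (- \<phi> (ys, s)) \<le> ennreal (F k ys I s)"
        using KL_integrand_neg_part_le[OF q_nonneg F_nonneg[OF ys], of ys s s]
        by (simp add: \<phi>_def e2ennreal_ereal_mult[OF q_nonneg, symmetric])
    qed
    then show ?thesis
      by (simp add: F_int[OF ys])
  qed
  then have "(\<integral>\<^sup>+ ys. B ys \<partial>traj_law M y j) \<le> (\<integral>\<^sup>+ ys. 1 \<partial>traj_law M y j)"
    by (intro nn_integral_mono) (simp add: space_law)
  then have "(\<integral>\<^sup>+ ys. B ys \<partial>traj_law M y j) \<le> 1"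
    by (simp add: L.emeasure_space_1)
  then have B_fin: "(\<integral>\<^sup>+ ys. B ys \<partial>traj_law M y j) \<noteq> \<infinity>"
    by (auto simp: top_unique)
  then show "(\<integral>\<^sup>+ \<omega>. e2ennreal (- log_ratio y p F I k \<omega>) \<partial>M) \<noteq> \<infinity>"
    by (simp add: B_int)
  have "KL_div (cond_density p k ys) (F k ys I) = enn2ereal (A ys) - enn2ereal (B ys)" for ys
    by (simp add: KL_div_def ext_integral_def A_def B_def \<phi>_def q_def[symmetric]
        e2ennreal_ereal_mult[OF q_nonneg] flip: ereal_mult_minus_right)
  then have "expected_KL M y p F I k =
      ext_integral (traj_law M y j) (\<lambda>ys. enn2ereal (A ys) - enn2ereal (B ys))"
    by (simp add: expected_KL_def j(1))
  also have "\<dots> = ext_integral M (log_ratio y p F I k)"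
    using B_fin by (subst ext_integral_diff_nonneg) (simp_all add: A_int B_int ext_integral_def)
  finally show "expected_KL M y p F I k = ext_integral M (log_ratio y p F I k)" .
qed

text \<open>Each predictive term is \<open>ln (p k / p (k - 1))\<close> minus a log-ratio, and the
  former telescope to \<open>ln (p n)\<close> because \<open>ln (p 0) = 0\<close>. Positivity keeps
  every \<open>l k\<close> real, so infinite values come only from the log-ratios.\<close>

lemma log_likelihood_telescope:
  assumes "p 0 (traj y 0 \<omega>) = 1" and pos: "\<And>k. k \<le> n \<Longrightarrow> 0 < p k (traj y k \<omega>)"
    and F: "\<And>k. k \<in> {1..n} \<Longrightarrow> 0 \<le> F k (traj y (k - 1) \<omega>) I (y k \<omega>)"
  shows "log_likelihood n F I (traj y n \<omega>) =
         eln (ereal (p n (traj y n \<omega>))) + (\<Sum>k=1..n. - log_ratio y p F I k \<omega>)"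
proof -
  define l where "l k = ln (p k (traj y k \<omega>))" for k
  have step: "eln (ereal (F k (past k (traj y n \<omega>)) I (traj y n \<omega> k))) =
        ereal (l k - l (k - 1)) + - log_ratio y p F I k \<omega>" if k: "k \<in> {1..n}" for k
  proof -
    obtain j where j: "k = Suc j" using k by (cases k) auto
    define a where "a = F k (traj y j \<omega>) I (y k \<omega>)"
    have pp: "0 < p k (traj y k \<omega>)" "0 < p j (traj y j \<omega>)"
      using pos k j by auto
    have F_eq: "traj y n \<omega> k = y k \<omega>" "past k (traj y n \<omega>) = traj y j \<omega>"
      using k j by (auto simp: traj_def past_def fun_eq_iff)
    have q: "cond_density p k (traj y j \<omega>) (y k \<omega>) = p k (traj y k \<omega>) / p j (traj y j \<omega>)"
      by (simp add: cond_density_def j traj_Suc)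
    have "0 \<le> a" using F[OF k] j by (simp add: a_def)
    then consider "a = 0" | "0 < a" by linarith
    then show ?thesis
    proof cases
      \<comment> \<open>A vanishing prediction makes the log-ratio \<open>\<infinity>\<close>, so
        both sides are \<open>-\<infinity>\<close>.\<close>
      case 1
      then show ?thesis
        using pp unfolding F_eq by (simp add: log_ratio_def q[unfolded j] j a_def[unfolded j, symmetric] eln_def divide_ereal_def
            flip: zero_ereal_def)
    next
      case 2
      then show ?thesis
        using pp unfolding F_eq by (simp add: log_ratio_def q[unfolded j] j a_def[unfolded j, symmetric] eln_ereal_pos
            ln_div ln_mult l_def)
    qed
  qed
  have "log_likelihood n F I (traj y n \<omega>) =
      (\<Sum>k=1..n. ereal (l k - l (k - 1)) + - log_ratio y p F I k \<omega>)"
    unfolding log_likelihood_def by (intro sum.cong refl step)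
  also have "\<dots> = ereal (\<Sum>k=1..n. l k - l (k - 1)) + (\<Sum>k=1..n. - log_ratio y p F I k \<omega>)"
    by (simp add: sum.distrib)
  also have "(\<Sum>k=1..n. l k - l (k - 1)) = l n - l 0"
    by (induction n) auto
  finally show ?thesis
    using assms(1) pos[of n] by (simp add: l_def eln_ereal_pos)
qed

lemma measurable_log_likelihood:
  assumes "online_predictor n F I"
  shows "log_likelihood n F I \<in> borel_measurable (traj_space n)"
proof -
  have "(\<lambda>ys. F k (past k ys) I (ys k)) \<in> borel_measurable (traj_space n)" if k: "k \<in> {1..n}" for k
  proof -
    have [measurable]: "(\<lambda>(ys, s). F k ys I s) \<in> borel_measurable (traj_space (k - 1) \<Otimes>\<^sub>M lborel)"
      using assms k by (auto simp: online_predictor_def)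
    have [measurable]: "past k \<in> measurable (traj_space n) (traj_space (k - 1))"
      unfolding past_def using k by (intro measurable_restrict_subset) auto
    have [measurable]: "(\<lambda>ys. ys k) \<in> measurable (traj_space n) lborel"
      using k by (intro measurable_component_singleton)
    have "(\<lambda>ys. (\<lambda>(ys, s). F k ys I s) (past k ys, ys k)) \<in> borel_measurable (traj_space n)"
      by measurable
    then show ?thesis by simp
  qed
  note [measurable] = this
  show ?thesis
    unfolding log_likelihood_def by measurable
qed

section \<open>Decomposition of the expected log-likelihood\<close>

theorem theorem1:
  fixes M :: "'a measure"
    and f :: "real^'dx \<Rightarrow> real^'du \<Rightarrow> real^'dx"
    and h :: "real^'dx \<Rightarrow> real^'dy"
    and x :: "nat \<Rightarrow> 'a \<Rightarrow> real^'dx"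
    and u :: "nat \<Rightarrow> 'a \<Rightarrow> real^'du"
    and w :: "nat \<Rightarrow> 'a \<Rightarrow> real^'dx"
    and v :: "nat \<Rightarrow> 'a \<Rightarrow> real^'dy"
    and y :: "nat \<Rightarrow> 'a \<Rightarrow> real^'dy"
    and n :: nat
    and p :: "nat \<Rightarrow> (nat \<Rightarrow> real^'dy) \<Rightarrow> real"
    and F :: "('i, 'dy) predictor"
    and I :: 'i
  assumes system: "stochastic_system M f h x u w v y"
    and densities: "joint_densities M y n p"
    and predictor: "online_predictor n F I"
    and entropy: "diff_entropy_exists n p"
    and determinate:
      "\<not> (diff_entropy n p = -\<infinity> \<and> (\<Sum>k=1..n. expected_KL M y p F I k) = \<infinity>)"
  shows "ext_integral_exists (traj_law M y n) (log_likelihood n F I) \<and>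
         expected_log_likelihood M y n F I =
           - diff_entropy n p - (\<Sum>k=1..n. expected_KL M y p F I k)"
proof -
  interpret stochastic_system M f h x u w v y by (rule system)
  note [measurable] = joint_densitiesD(3)[OF densities order_refl] joint_densitiesD(4)[OF densities order_refl]
    measurable_log_likelihood[OF predictor]
  note ratio = expected_KL_eq_log_ratio[OF prob_space_axioms densities predictor]
  let ?g = "\<lambda>\<omega>. eln (ereal (p n (traj y n \<omega>)))"
  let ?H = "\<lambda>\<omega>. \<Sum>k=1..n. - log_ratio y p F I k \<omega>"
  let ?LL = "\<lambda>\<omega>. log_likelihood n F I (traj y n \<omega>)"
  let ?S = "\<Sum>k=1..n. expected_KL M y p F I k"
  note [measurable] = ratio(1)

  \<comment> \<open>The factor \<open>p n\<close> turns Lebesgue measure into the law of the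
    trajectory, so the entropy is minus an expectation of \<open>ln (p n)\<close>, part by
    part.\<close>
  have "(\<integral>\<^sup>+ ys. e2ennreal (ereal (p n ys) * eln (ereal (p n ys))) \<partial>traj_space n) =
        (\<integral>\<^sup>+ \<omega>. e2ennreal (?g \<omega>) \<partial>M)"
    using distributed_nn_integral[OF joint_densitiesD(1)[OF densities order_refl],
        of "\<lambda>ys. e2ennreal (eln (ereal (p n ys)))"] joint_densitiesD(2)[OF densities order_refl]
    by (simp add: e2ennreal_ereal_mult)
  moreover have "(\<integral>\<^sup>+ ys. e2ennreal (- (ereal (p n ys) * eln (ereal (p n ys)))) \<partial>traj_space n) =
        (\<integral>\<^sup>+ \<omega>. e2ennreal (- ?g \<omega>) \<partial>M)"
    using distributed_nn_integral[OF joint_densitiesD(1)[OF densities order_refl],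
        of "\<lambda>ys. e2ennreal (- eln (ereal (p n ys)))"] joint_densitiesD(2)[OF densities order_refl]
    by (simp add: e2ennreal_ereal_mult flip: ereal_mult_minus_right)
  ultimately have ent: "diff_entropy n p = - ext_integral M ?g"
    and g_ex: "\<not> ((\<integral>\<^sup>+ \<omega>. e2ennreal (?g \<omega>) \<partial>M) = \<infinity> \<and> (\<integral>\<^sup>+ \<omega>. e2ennreal (- ?g \<omega>) \<partial>M) = \<infinity>)"
    using entropy by (auto simp: diff_entropy_def diff_entropy_exists_def ext_integral_exists_def
        ext_integral_def)

  have H: "ext_integral M ?H = (\<Sum>k=1..n. ext_integral M (\<lambda>\<omega>. - log_ratio y p F I k \<omega>)) \<and>
      (\<integral>\<^sup>+ \<omega>. e2ennreal (?H \<omega>) \<partial>M) \<noteq> \<infinity>"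
    by (rule ext_integral_sum) (use ratio in auto)
  have neg: "ext_integral M (\<lambda>\<omega>. - log_ratio y p F I k \<omega>) = - expected_KL M y p F I k \<and>
      expected_KL M y p F I k \<noteq> -\<infinity>" if "k \<in> {1..n}" for k
    using ratio(2,3)[OF that]
    by (subst ext_integral_uminus) (auto simp: ext_integral_neq_MInf)
  \<comment> \<open>Negation distributes over sums in \<open>ereal\<close> only away from opposite
    infinities; no expected divergence is \<open>-\<infinity>\<close>.\<close>
  have add_neg: "- a + - b = - (a + b) \<and> a + b \<noteq> -\<infinity>" if "a \<noteq> -\<infinity>" "b \<noteq> -\<infinity>" for a b :: ereal
    using that by (cases a; cases b) auto
  have S: "(\<Sum>k\<in>K. - expected_KL M y p F I k) = - (\<Sum>k\<in>K. expected_KL M y p F I k) \<and>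
      (\<Sum>k\<in>K. expected_KL M y p F I k) \<noteq> -\<infinity>" if "K \<subseteq> {1..n}" for K
    using finite_subset[OF that finite_atLeastAtMost] that
  proof (induction K rule: finite_induct)
    case (insert k K)
    then show ?case
      using neg[of k] add_neg[of "expected_KL M y p F I k" "\<Sum>k\<in>K. expected_KL M y p F I k"]
      by simp
  qed simp
  have HS: "ext_integral M ?H = - ?S"
    using H neg S[of "{1..n}"] by simp

  have "AE \<omega> in M. \<forall>k\<in>{..n}. 0 < p k (traj y k \<omega>)"
    using joint_densities_AE_pos[OF prob_space_axioms densities] by (intro AE_finite_allI) auto
  moreover have "AE \<omega> in M. \<forall>k\<in>{1..n}. 0 \<le> F k (traj y (k - 1) \<omega>) I (y k \<omega>)"
  proof (rule AE_I2, rule ballI)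
    fix \<omega> k assume "\<omega> \<in> space M" and k: "k \<in> {1..n}"
    then have "traj y (k - 1) \<omega> \<in> space (traj_space (k - 1))"
      by (auto simp: traj_def space_PiM)
    then show "0 \<le> F k (traj y (k - 1) \<omega>) I (y k \<omega>)"
      using predictor k by (auto simp: online_predictor_def)
  qed
  ultimately have ae: "AE \<omega> in M. ?LL \<omega> = ?g \<omega> + ?H \<omega>"
    by eventually_elim
       (rule log_likelihood_telescope, auto intro: joint_density_0[OF prob_space_axioms densities])

  \<comment> \<open>The positive part of \<open>?H\<close> is always integrable, so only an infinite
    positive part of \<open>?g\<close> is critical. The entropy is then \<open>-\<infinity>\<close>,
    and \<open>determinate\<close> keeps the sum of divergences below \<open>\<infinity>\<close>,
    which makes both negative parts integrable.\<close>
  have fin: "(\<integral>\<^sup>+ \<omega>. e2ennreal (?g \<omega>) \<partial>M) \<noteq> \<infinity> \<and> (\<integral>\<^sup>+ \<omega>. e2ennreal (?H \<omega>) \<partial>M) \<noteq> \<infinity> \<or>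
      (\<integral>\<^sup>+ \<omega>. e2ennreal (- ?g \<omega>) \<partial>M) \<noteq> \<infinity> \<and> (\<integral>\<^sup>+ \<omega>. e2ennreal (- ?H \<omega>) \<partial>M) \<noteq> \<infinity>"
  proof (cases "(\<integral>\<^sup>+ \<omega>. e2ennreal (?g \<omega>) \<partial>M) = \<infinity>")
    case True
    then have g: "(\<integral>\<^sup>+ \<omega>. e2ennreal (- ?g \<omega>) \<partial>M) \<noteq> \<infinity>"
      using g_ex by auto
    then have "diff_entropy n p = -\<infinity>"
      using True by (simp add: ent ext_integral_def)
    then have "?S \<noteq> \<infinity>"
      using determinate by auto
    then have "ext_integral M ?H \<noteq> -\<infinity>"
      unfolding HS by (simp add: ereal_uminus_eq_reorder)
    then have "(\<integral>\<^sup>+ \<omega>. e2ennreal (- ?H \<omega>) \<partial>M) \<noteq> \<infinity>"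
      using H unfolding ext_integral_def
      by (cases "\<integral>\<^sup>+ \<omega>. e2ennreal (?H \<omega>) \<partial>M") (auto simp: enn2ereal_ennreal)
    with g show ?thesis by auto
  next
    case False
    with H show ?thesis by auto
  qed
  have gm: "?g \<in> borel_measurable M" "?H \<in> borel_measurable M"
    by measurable
  note add = ext_integral_add[OF gm fin]

  have "(\<integral>\<^sup>+ \<omega>. e2ennreal (?LL \<omega>) \<partial>M) = (\<integral>\<^sup>+ \<omega>. e2ennreal (?g \<omega> + ?H \<omega>) \<partial>M)"
       "(\<integral>\<^sup>+ \<omega>. e2ennreal (- ?LL \<omega>) \<partial>M) = (\<integral>\<^sup>+ \<omega>. e2ennreal (- (?g \<omega> + ?H \<omega>)) \<partial>M)"
    by (rule nn_integral_cong_AE, use ae in eventually_elim, simp)+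
  \<comment> \<open>Whichever sign has finite parts in both \<open>?g\<close> and \<open>?H\<close>
    also has a finite part in their sum, hence in the log-likelihood.\<close>
  then have ex: "ext_integral_exists (traj_law M y n) (log_likelihood n F I)"
    using fin add(2,3) by (auto simp: ext_integral_exists_def traj_law_def nn_integral_distr)
  have "expected_log_likelihood M y n F I = ext_integral M ?LL"
    by (simp add: expected_log_likelihood_def traj_law_def ext_integral_distr)
  also have "\<dots> = ext_integral M (\<lambda>\<omega>. ?g \<omega> + ?H \<omega>)"
    by (rule ext_integral_cong_AE) (rule ae)
  also have "\<dots> = - diff_entropy n p - ?S"
    by (simp add: add(1) ent HS minus_ereal_def)
  finally show ?thesis
    using ex by simp
qed

end
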